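(* Let $\mathbb X$ be a Banach space over $\mathbb K=\mathbb R$ or $\mathbb C$ and let $\{\mathbf e_n,\mathbf e_n^*\}_{n=1}^\infty$ be a semi-normalized biorthogonal system in $\mathbb X\times\mathbb X^*$ whose vectors $\mathbf e_n$ have dense span (as in the context). Then for all $N\ge1$ $$\mathbf L_N\le k^c_{2N}\,\nu_N\qquad\text{and}\qquad\widetilde{\mathbf L}_N\le g_N^c\,\nu_N .$$ Moreover, there exists such a pair $(\mathbb X,\mathscr B)$, $\mathscr B=\{\mathbf e_n\}$, for which both inequalities are equalities for all $N\ge 1$.
   Context: Setting: $\mathbb X$ is a Banach space over $\mathbb K=\mathbb R$ or $\mathbb C$; $\{\mathbf e_n,\mathbf e_n^*\}_{n=1}^\infty\subset\mathbb X\times\mathbb X^*$ satisfies $\mathbf e_m^*(\mathbf e_n)=\delta_{m,n}$; $\mathscr B=\{\mathbf e_n\}$ has dense linear span in $\mathbb X$; and $0<\kappa_1\le\|\mathbf e_n\|,\|\mathbf e_n^*\|\le\kappa_2<\infty$ for all $n$. (Then $\lim_n\mathbf e_n^*(x)=0$ for all $x\in\mathbb X$.) Projections: for finite $A\subset\mathbb N$, $P_Ax=\sum_{n\in A}\mathbf e_n^*(x)\mathbf e_n$. Greedy sets: a finite set $\Gamma\subset\mathbb N$ is a greedy set for $x$ if $\min_{n\in\Gamma}|\mathbf e_n^*(x)|\ge\max_{n\in\Gamma^c}|\mathbf e_n^*(x)|$; $\mathscr G(x,N)$ is the collection of greedy sets for $x$ of cardinality $N$. $\mathscr G_N$ is the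 set of all maps $G:\mathbb X\to\mathbb X$ with $Gx=P_{\Gamma_x}x$ for some choice $\Gamma_x\in\mathscr G(x,N)$, for each $x$. Approximation errors: $\Sigma_N=\{\sum_{n\in A}a_n\mathbf e_n: |A|\le N,\ a_n\in\mathbb K\}$, $\sigma_N(x)=\operatorname{dist}(x,\Sigma_N)$, $\widetilde\sigma_N(x)=\inf\{\|x-P_Ax\|: |A|\le N\}$. Lebesgue constants: $\mathbf L_N$ (resp. $\widetilde{\mathbf L}_N$) is the smallest number such that $\|x-Gx\|\le\mathbf L_N\sigma_N(x)$ (resp. $\|x-Gx\|\le\widetilde{\mathbf L}_N\widetilde\sigma_N(x)$) for all $x\in\mathbb X$ and all $G\in\mathscr G_N$. Other constants: $k_N^c=\sup_{|A|\le N}\|I-P_A\|$; $g_N^c=\sup\{\|x-P_\Gamma x\|/\|x\|: x\ne0,\ \Gamma\in\mathscr G(x,k),\ 1\le k\le N\}$. $\Upsilon$ is the set of sequences $\boldsymbol\varepsilon=\{\varepsilon_n\}$ in $\mathbb K$ with $|\varepsilon_n|=1$ for all $n$; $\mathbf 1_{\boldsymbol\varepsilon A}=\sum_{n\in A}\varepsilon_n\mathbf e_n$. $\nu_N$ is the supremum of $\|\mathbf 1_{\boldsymbol\varepsilon A}+x\|/\|\mathbf 1_{\boldsymbol\eta B}+x\|$ over all $|A|=|B|\le N$ (nonempty), $\boldsymbol\varepsilon,\boldsymbol\eta\in\Upsilon$, and $x\in\mathbb X$ with $|x|_\infty:=\sup_n|\mathbf e_n^*(x)|\le1$ such that $A$,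 $B$ and $\operatorname{supp}x=\{n:\mathbf e_n^*(x)\ne0\}$ are pairwise disjoint. *)

theory Defs
  imports "HOL-Analysis.Analysis"
begin

text \<open>
  The scalar field is a type \<open>'k\<close> of sort \<open>{real_normed_field, banach}\<close>; up to isometric
  isomorphism its only instances are \<open>real\<close> and \<open>complex\<close>.  The library has no complex normed spaces
  and HOL cannot quantify existentially over types, so a Banach space over \<open>'k\<close> is a complete linear
  subspace \<open>X\<close> of a normed space \<open>'a\<close> that carries a scalar multiplication by \<open>'k\<close> extending \<open>scaleR\<close>
  (\<open>X = UNIV\<close> being allowed).  Existence of a space with a given kind of basis can then be stated
  for subspaces of \<open>(nat, 'k) bcontfun\<close>, i.e. \<open>l\<close>-infinity over \<open>'k\<close>: such a space is separable, and
  every separable Banach space over \<open>'k\<close> embeds isometrically there.  The basis is indexed by \<open>nat\<close> starting at 0.  Constants defined as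
  suprema, and the Lebesgue constants, take values in \<open>ennreal\<close>, so that they make sense without a
  prior proof of finiteness.
\<close>

locale banach_space_over =
  vector_space smul
  for smul :: "'k::{real_normed_field,banach} \<Rightarrow> 'a::real_normed_vector \<Rightarrow> 'a" +
  fixes X :: "'a set"
  assumes scale_of_real: "smul (of_real r) x = r *\<^sub>R x"
    and norm_scale: "norm (smul c x) = norm c * norm x"
    and subspace_X: "module.subspace smul X"
    and complete_X: "complete X"

definition dual_space ::
  "('k::real_normed_field \<Rightarrow> 'a::real_normed_vector \<Rightarrow> 'a) \<Rightarrow> 'a set \<Rightarrow> ('a \<Rightarrow> 'k) set" where
  "dual_space smul X = {f. (\<forall>x\<in>X. \<forall>y\<in>X. f (x + y) = f x + f y)
      \<and> (\<forall>c. \<forall>x\<in>X. f (smul c x) = c * f x)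
      \<and> (\<exists>K. \<forall>x\<in>X. norm (f x) \<le> K * norm x)}"

text \<open>Operator norm of a map restricted to \<open>X\<close>; as for \<open>onorm\<close>, the point 0 contributes \<open>0/0 = 0\<close>.\<close>

definition onorm_on :: "'a::real_normed_vector set \<Rightarrow> ('a \<Rightarrow> 'b::real_normed_vector) \<Rightarrow> ennreal" where
  "onorm_on X f = (SUP x\<in>X. ennreal (norm (f x) / norm x))"

locale seminormalized_biorthogonal_system =
  banach_space_over smul X
  for smul :: "'k::{real_normed_field,banach} \<Rightarrow> 'a::real_normed_vector \<Rightarrow> 'a" and X :: "'a set" +
  fixes e :: "nat \<Rightarrow> 'a" and es :: "nat \<Rightarrow> 'a \<Rightarrow> 'k"
  assumes e_in: "e n \<in> X"
    and es_in: "es n \<in> dual_space smul X"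
    and biorthogonal: "es m (e n) = (if m = n then 1 else 0)"
    and dense_span: "X \<subseteq> closure (module.span smul (range e))"
    and seminormalized:
      "\<exists>\<kappa>1 \<kappa>2 :: real. 0 < \<kappa>1 \<and> (\<forall>n. \<kappa>1 \<le> norm (e n) \<and> norm (e n) \<le> \<kappa>2 \<and>
         ennreal \<kappa>1 \<le> onorm_on X (es n) \<and> onorm_on X (es n) \<le> ennreal \<kappa>2)"

definition proj ::
  "('k \<Rightarrow> 'a::comm_monoid_add \<Rightarrow> 'a) \<Rightarrow> (nat \<Rightarrow> 'a) \<Rightarrow> (nat \<Rightarrow> 'a \<Rightarrow> 'k) \<Rightarrow> nat set \<Rightarrow> 'a \<Rightarrow> 'a" where
  "proj smul e es A x = (\<Sum>n\<in>A. smul (es n x) (e n))"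

text \<open>The condition "minimum over \<open>\<Gamma>\<close> \<open>\<ge>\<close> maximum over the complement" is written pairwise.\<close>

definition greedy_sets :: "(nat \<Rightarrow> 'a \<Rightarrow> 'k::real_normed_field) \<Rightarrow> 'a \<Rightarrow> nat \<Rightarrow> nat set set" where
  "greedy_sets es x N = {\<Gamma>. finite \<Gamma> \<and> card \<Gamma> = N \<and>
      (\<forall>n\<in>\<Gamma>. \<forall>m\<in>-\<Gamma>. norm (es n x) \<ge> norm (es m x))}"

definition greedy_operators ::
  "('k::real_normed_field \<Rightarrow> 'a::real_normed_vector \<Rightarrow> 'a) \<Rightarrow> 'a set \<Rightarrow> (nat \<Rightarrow> 'a) \<Rightarrow>
   (nat \<Rightarrow> 'a \<Rightarrow> 'k) \<Rightarrow> nat \<Rightarrow> ('a \<Rightarrow> 'a) set" where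
  "greedy_operators smul X e es N =
     {G. \<forall>x\<in>X. \<exists>\<Gamma>\<in>greedy_sets es x N. G x = proj smul e es \<Gamma> x}"

definition Sigma_N ::
  "('k \<Rightarrow> 'a::comm_monoid_add \<Rightarrow> 'a) \<Rightarrow> (nat \<Rightarrow> 'a) \<Rightarrow> nat \<Rightarrow> 'a set" where
  "Sigma_N smul e N = {(\<Sum>n\<in>A. smul (a n) (e n)) | A a. finite A \<and> card A \<le> N}"

definition sigma_err ::
  "('k \<Rightarrow> 'a::real_normed_vector \<Rightarrow> 'a) \<Rightarrow> (nat \<Rightarrow> 'a) \<Rightarrow> nat \<Rightarrow> 'a \<Rightarrow> real" where
  "sigma_err smul e N x = infdist x (Sigma_N smul e N)"

definition sigma_tilde_err ::
  "('k \<Rightarrow> 'a::real_normed_vector \<Rightarrow> 'a) \<Rightarrow> (nat \<Rightarrow> 'a) \<Rightarrow> (nat \<Rightarrow> 'a \<Rightarrow> 'k) \<Rightarrow> nat \<Rightarrow> 'a \<Rightarrow> real" where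
  "sigma_tilde_err smul e es N x =
     (INF A\<in>{A. finite A \<and> card A \<le> N}. norm (x - proj smul e es A x))"

text \<open>
  The set of admissible constants is closed, so the infimum is its smallest element; it is
  \<open>\<infinity>\<close> (\<open>Inf {}\<close>) if no finite constant is admissible.
\<close>

definition lebesgue_const ::
  "('k::real_normed_field \<Rightarrow> 'a::real_normed_vector \<Rightarrow> 'a) \<Rightarrow> 'a set \<Rightarrow> (nat \<Rightarrow> 'a) \<Rightarrow>
   (nat \<Rightarrow> 'a \<Rightarrow> 'k) \<Rightarrow> nat \<Rightarrow> ennreal" where
  "lebesgue_const smul X e es N = Inf {ennreal C | C. 0 \<le> C \<and>
     (\<forall>x\<in>X. \<forall>G\<in>greedy_operators smul X e es N. norm (x - G x) \<le> C * sigma_err smul e N x)}"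

definition lebesgue_tilde_const ::
  "('k::real_normed_field \<Rightarrow> 'a::real_normed_vector \<Rightarrow> 'a) \<Rightarrow> 'a set \<Rightarrow> (nat \<Rightarrow> 'a) \<Rightarrow>
   (nat \<Rightarrow> 'a \<Rightarrow> 'k) \<Rightarrow> nat \<Rightarrow> ennreal" where
  "lebesgue_tilde_const smul X e es N = Inf {ennreal C | C. 0 \<le> C \<and>
     (\<forall>x\<in>X. \<forall>G\<in>greedy_operators smul X e es N. norm (x - G x) \<le> C * sigma_tilde_err smul e es N x)}"

definition kc_const ::
  "('k::real_normed_field \<Rightarrow> 'a::real_normed_vector \<Rightarrow> 'a) \<Rightarrow> 'a set \<Rightarrow> (nat \<Rightarrow> 'a) \<Rightarrow>
   (nat \<Rightarrow> 'a \<Rightarrow> 'k) \<Rightarrow> nat \<Rightarrow> ennreal" where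
  "kc_const smul X e es N =
     (SUP A\<in>{A. finite A \<and> card A \<le> N}. onorm_on X (\<lambda>x. x - proj smul e es A x))"

definition gc_const ::
  "('k::real_normed_field \<Rightarrow> 'a::real_normed_vector \<Rightarrow> 'a) \<Rightarrow> 'a set \<Rightarrow> (nat \<Rightarrow> 'a) \<Rightarrow>
   (nat \<Rightarrow> 'a \<Rightarrow> 'k) \<Rightarrow> nat \<Rightarrow> ennreal" where
  "gc_const smul X e es N =
     Sup {ennreal (norm (x - proj smul e es \<Gamma> x) / norm x) | x \<Gamma> k.
       x \<in> X \<and> x \<noteq> 0 \<and> \<Gamma> \<in> greedy_sets es x k \<and> 1 \<le> k \<and> k \<le> N}"

definition Upsilon :: "(nat \<Rightarrow> 'k::real_normed_field) set" where
  "Upsilon = {\<epsilon>. \<forall>n. norm (\<epsilon> n) = 1}"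

definition signed_sum ::
  "('k \<Rightarrow> 'a::comm_monoid_add \<Rightarrow> 'a) \<Rightarrow> (nat \<Rightarrow> 'a) \<Rightarrow> (nat \<Rightarrow> 'k) \<Rightarrow> nat set \<Rightarrow> 'a" where
  "signed_sum smul e \<epsilon> A = (\<Sum>n\<in>A. smul (\<epsilon> n) (e n))"

definition coeff_supp :: "(nat \<Rightarrow> 'a \<Rightarrow> 'k::zero) \<Rightarrow> 'a \<Rightarrow> nat set" where
  "coeff_supp es x = {n. es n x \<noteq> 0}"

definition coeff_sup_norm :: "(nat \<Rightarrow> 'a \<Rightarrow> 'k::real_normed_field) \<Rightarrow> 'a \<Rightarrow> ennreal" where
  "coeff_sup_norm es x = (SUP n. ennreal (norm (es n x)))"

definition nu_const ::
  "('k::real_normed_field \<Rightarrow> 'a::real_normed_vector \<Rightarrow> 'a) \<Rightarrow> 'a set \<Rightarrow> (nat \<Rightarrow> 'a) \<Rightarrow>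
   (nat \<Rightarrow> 'a \<Rightarrow> 'k) \<Rightarrow> nat \<Rightarrow> ennreal" where
  "nu_const smul X e es N =
     Sup {ennreal (norm (signed_sum smul e \<epsilon> A + x) / norm (signed_sum smul e \<eta> B + x)) | A B \<epsilon> \<eta> x.
       finite A \<and> finite B \<and> A \<noteq> {} \<and> B \<noteq> {} \<and> card A = card B \<and> card A \<le> N \<and>
       \<epsilon> \<in> Upsilon \<and> \<eta> \<in> Upsilon \<and> x \<in> X \<and> coeff_sup_norm es x \<le> 1 \<and>
       A \<inter> B = {} \<and> A \<inter> coeff_supp es x = {} \<and> B \<inter> coeff_supp es x = {}}"

end

theory Submission
  imports Defs
begin

text \<open>
  Let \<open>\<Gamma>\<close> be a greedy set for \<open>x\<close>, let \<open>A\<close> be the index set of an approximant and let \<open>\<alpha>\<close> be the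
  smallest modulus of a coefficient of \<open>x\<close> on \<open>\<Gamma>\<close>.  The coefficients of \<open>x - P\<^sub>\<Gamma> x\<close> have modulus at
  most \<open>\<alpha>\<close>, so by convexity those on \<open>A - \<Gamma>\<close> may be replaced by unimodular multiples of \<open>\<alpha>\<close>, and then,
  at the cost of the factor \<open>\<nu>\<^sub>N\<close>, by coefficients \<open>\<alpha> sign(x\<^sub>n)\<close> placed on \<open>\<Gamma> - A\<close>.  The result is
  \<open>y = x - P\<^sub>A x\<close> with the coefficients on \<open>\<Gamma> - A\<close> multiplied by numbers \<open>t\<^sub>n\<close> in \<open>[0, 1]\<close>.  Writing
  \<open>t\<^sub>n\<close> as the integral over \<open>s\<close> in \<open>[0, 1]\<close> of the indicator of \<open>s < t\<^sub>n\<close> exhibits it as an average of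
  vectors \<open>y - P\<^sub>R y\<close> with \<open>R\<close> greedy for \<open>y\<close>, whose norms are at most \<open>g\<^sub>N \<parallel>y\<parallel>\<close>; they are also
  complementary projections of \<open>x - z\<close> for every \<open>z\<close> supported on \<open>A\<close>, which gives the bound with
  \<open>k\<^sub>2\<^sub>N\<close>.  For the unit vectors of \<open>c\<^sub>0\<close> all the constants are equal to 1.
\<close>

section \<open>Averaging in normed spaces and selection of largest elements\<close>

text \<open>Since \<open>t n\<close> is the integral of the indicator of \<open>s < t n\<close>, the
  vector is the mean over \<open>s\<close> of the vectors bounded by \<open>M\<close>, and the norm
  of a mean is at most \<open>M\<close>. The family \<open>v\<close> is arbitrary because two
  averages are needed: one between opposite unimodular coefficients, one over deleted greedy
  sets.\<close>

lemma norm_layer_cake_le: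
  fixes v :: "'i \<Rightarrow> 'a::real_normed_vector"
  assumes "finite B"
    and t: "\<And>n. n \<in> B \<Longrightarrow> 0 \<le> t n \<and> t n \<le> 1"
    and M: "\<And>s. 0 \<le> s \<Longrightarrow> s \<le> 1 \<Longrightarrow> norm (w + (\<Sum>n\<in>{n\<in>B. s < t n}. v n)) \<le> M"
  shows "norm (w + (\<Sum>n\<in>B. t n *\<^sub>R v n)) \<le> M"
proof -
  have step: "((\<lambda>s. if s < a then 1 else (0::real)) has_integral a) {0..1}" if "0 \<le> a" "a \<le> 1" for a :: real
  proof -
    have "((\<lambda>s. 1::real) has_integral a) {0..a}"
      using has_integral_const_real[of "1::real" 0 a] that by simp
    then have "((\<lambda>s. if s \<in> {0..a} then 1 else (0::real)) has_integral a) {0..1}"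
      using has_integral_restrict[of "{0..a}" "{0..1}" "\<lambda>s. 1::real" a] that by auto
    \<comment> \<open>The indicators of \<open>s \<le> a\<close> and \<open>s < a\<close> differ
      only at \<open>s = a\<close>.\<close>
    then show ?thesis
      by (rule has_integral_spike[where S = "{a}", rotated 2]) auto
  qed
  have int: "((\<lambda>s. w + (\<Sum>n\<in>B. (if s < t n then 1 else (0::real)) *\<^sub>R v n)) has_integral
          (w + (\<Sum>n\<in>B. t n *\<^sub>R v n))) {0..1}"
    using has_integral_const_real[of w 0 1]
    by (intro has_integral_add has_integral_sum has_integral_scaleR_left step \<open>finite B\<close>) (use t in auto)
  have le: "norm (w + (\<Sum>n\<in>B. (if s < t n then 1 else (0::real)) *\<^sub>R v n)) \<le> M"
    if "s \<in> {0..1}" for s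
  proof -
    have "(\<Sum>n\<in>B. (if s < t n then 1 else (0::real)) *\<^sub>R v n) = (\<Sum>n\<in>{n\<in>B. s < t n}. v n)"
      by (simp add: if_distrib[of "\<lambda>c. c *\<^sub>R _"] sum.inter_filter \<open>finite B\<close> cong: if_cong)
    then show ?thesis using M[of s] that by simp
  qed
  have "0 \<le> M" using order_trans[OF norm_ge_zero M[of 0]] by simp
  from has_integral_bound_real[OF this finite.emptyI int] le show ?thesis
    by simp
qed

text \<open>Each induction step adds a maximiser of \<open>f\<close> over the remaining elements;
  the induction hypothesis places it below all elements chosen before.\<close>

lemma exists_largest_subset:
  fixes f :: "'i \<Rightarrow> 'b::linorder"
  assumes "finite B" "k \<le> card B"
  obtains D where "D \<subseteq> B" "card D = k" "\<And>n m. n \<in> D \<Longrightarrow> m \<in> B - D \<Longrightarrow> f m \<le> f n"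
  using assms(2)
proof (induction k arbitrary: thesis)
  case 0
  show ?case by (rule 0(1)[of "{}"]) auto
next
  case (Suc k)
  obtain D where D: "D \<subseteq> B" "card D = k" "\<And>n m. n \<in> D \<Longrightarrow> m \<in> B - D \<Longrightarrow> f m \<le> f n"
    using Suc.IH Suc.prems(2) by (metis Suc_leD)
  have fin: "finite (B - D)" "finite D" using D(1) assms(1) finite_subset by auto
  have "B - D \<noteq> {}" using D Suc.prems(2) assms(1) by auto
  then have "Max (f ` (B - D)) \<in> f ` (B - D)" using fin by simp
  then obtain a where a: "a \<in> B - D" "f a = Max (f ` (B - D))" by auto
  have "f m \<le> f a" if "m \<in> B - D" for m using a(2) that fin by simp
  then show ?case
    using D a fin by (intro Suc.prems(1)[of "insert a D"]) auto
qed

section \<open>Reduction to unimodular coefficients\<close>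

context banach_space_over
begin

lemma smul_of_real: "smul (of_real r * c) x = r *\<^sub>R smul c x"
  using scale_of_real scale_scale by metis

text \<open>A convex function on a polydisc is bounded by its values on the torus. Only two points
  of each circle are needed: \<open>c n\<close> lies on the segment from \<open>- u n\<close> to
  \<open>u n\<close>, so \<open>norm_layer_cake_le\<close> applies with all coefficients
  \<open>- u n\<close> as starting point.\<close>

lemma norm_unimodular_combination_le:
  fixes e :: "nat \<Rightarrow> 'a"
  assumes "finite A" and c: "\<And>n. n \<in> A \<Longrightarrow> norm (c n) \<le> 1"
    and M: "\<And>\<epsilon>. \<epsilon> \<in> Upsilon \<Longrightarrow> norm (w + signed_sum smul e \<epsilon> A) \<le> M"
  shows "norm (w + (\<Sum>n\<in>A. smul (c n) (e n))) \<le> M"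
proof -
  \<comment> \<open>The default value 1 keeps \<open>u n\<close> unimodular when
    \<open>c n = 0\<close>.\<close>
  define u where "u n = (if c n = 0 then 1 else c n / of_real (norm (c n)))" for n
  define t where "t n = (1 + norm (c n)) / 2" for n
  have u: "norm (u n) = 1" "of_real (norm (c n)) * u n = c n" for n
    by (auto simp: u_def norm_divide)
  \<comment> \<open>Every \<open>c n\<close> of modulus at most 1 is the convex combination of \<open>u n\<close> and \<open>- u n\<close> with weight \<open>t n\<close> on \<open>u n\<close>.\<close>
  have c_eq: "smul (c n) x = - smul (u n) x + t n *\<^sub>R (2 *\<^sub>R smul (u n) x)" for n x
  proof -
    have "smul (c n) x = norm (c n) *\<^sub>R smul (u n) x"
      by (metis u(2) smul_of_real)
    moreover have "t n *\<^sub>R (2 *\<^sub>R smul (u n) x) = (1 + norm (c n)) *\<^sub>R smul (u n) x"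
      by (simp add: t_def)
    ultimately show ?thesis by (simp add: scaleR_left_distrib)
  qed
  have "norm ((w - signed_sum smul e u A) + (\<Sum>n\<in>A. t n *\<^sub>R (2 *\<^sub>R smul (u n) (e n)))) \<le> M"
  proof (rule norm_layer_cake_le[OF \<open>finite A\<close>])
    show "0 \<le> t n \<and> t n \<le> 1" if "n \<in> A" for n using c[OF that] by (auto simp: t_def)
    fix s :: real
    \<comment> \<open>At level \<open>s\<close> exactly the indices with \<open>s < t n\<close> are
      flipped from \<open>- u n\<close> to \<open>u n\<close>.\<close>
    define \<epsilon> where "\<epsilon> n = (if s < t n then u n else - u n)" for n
    have "signed_sum smul e \<epsilon> A
        = (\<Sum>n\<in>A. - smul (u n) (e n) + (if s < t n then 2 *\<^sub>R smul (u n) (e n) else 0))"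
      unfolding signed_sum_def
      by (rule sum.cong) (auto simp: \<epsilon>_def scaleR_2)
    also have "\<dots> = - signed_sum smul e u A + (\<Sum>n\<in>{n \<in> A. s < t n}. 2 *\<^sub>R smul (u n) (e n))"
      by (simp add: sum_subtractf signed_sum_def sum.inter_filter \<open>finite A\<close>)
    finally have eq: "w - signed_sum smul e u A + (\<Sum>n\<in>{n \<in> A. s < t n}. 2 *\<^sub>R smul (u n) (e n))
        = w + signed_sum smul e \<epsilon> A" by simp
    have "\<epsilon> \<in> Upsilon" by (auto simp: Upsilon_def \<epsilon>_def u)
    then show "norm (w - signed_sum smul e u A
        + (\<Sum>n\<in>{n \<in> A. s < t n}. 2 *\<^sub>R smul (u n) (e n))) \<le> M" unfolding eq by (rule M)
  qed
  moreover have "w + (\<Sum>n\<in>A. smul (c n) (e n))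
      = w - signed_sum smul e u A + (\<Sum>n\<in>A. t n *\<^sub>R (2 *\<^sub>R smul (u n) (e n)))"
    by (simp add: c_eq sum.distrib sum_negf sum_subtractf signed_sum_def)
  ultimately show ?thesis by (simp only:)
qed

end

section \<open>Coefficients of combinations and projections\<close>

context seminormalized_biorthogonal_system
begin

lemma es_add: "x \<in> X \<Longrightarrow> y \<in> X \<Longrightarrow> es n (x + y) = es n x + es n y"
  using es_in[of n] by (simp add: dual_space_def)

lemma es_scale: "x \<in> X \<Longrightarrow> es n (smul c x) = c * es n x"
  using es_in[of n] by (simp add: dual_space_def)

lemma X_0: "0 \<in> X"
  by (rule subspace_0[OF subspace_X])

lemma X_diff: "x \<in> X \<Longrightarrow> y \<in> X \<Longrightarrow> x - y \<in> X"
  by (rule subspace_diff[OF subspace_X])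

lemma X_scale: "x \<in> X \<Longrightarrow> smul c x \<in> X"
  by (rule subspace_scale[OF subspace_X])

lemma X_combination: "(\<Sum>n\<in>A. smul (c n) (e n)) \<in> X"
  by (rule subspace_sum[OF subspace_X]) (rule X_scale[OF e_in])

lemma X_proj: "proj smul e es A x \<in> X"
  unfolding proj_def by (rule X_combination)

lemma es_0: "es n 0 = 0"
  using es_scale[OF X_0, of n 0] by simp

lemma es_diff: "x \<in> X \<Longrightarrow> y \<in> X \<Longrightarrow> es n (x - y) = es n x - es n y"
  using es_add[OF X_diff, of x y y n] by (simp only: diff_add_cancel) (simp only: add_diff_cancel_right')

lemma es_combination:
  assumes "finite A"
  shows "es n (\<Sum>m\<in>A. smul (c m) (e m)) = (if n \<in> A then c n else 0)"
  using assms
proof (induction A)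
  case empty
  then show ?case by (simp add: es_0)
next
  case (insert a A)
  then show ?case
    by (auto simp: es_add X_scale X_combination e_in es_scale biorthogonal)
qed

lemma es_proj: "finite A \<Longrightarrow> es n (proj smul e es A x) = (if n \<in> A then es n x else 0)"
  unfolding proj_def by (rule es_combination)

lemma es_diff_proj:
  "finite A \<Longrightarrow> x \<in> X \<Longrightarrow> es n (x - proj smul e es A x) = (if n \<in> A then 0 else es n x)"
  by (simp add: es_diff es_proj X_proj)

lemma e_nz: "e n \<noteq> 0"
  using biorthogonal[of n n] es_0 by auto

section \<open>The constants k, g and nu as real bounds, and their lower bound 1\<close>

lemma ratio_le_kc:
  assumes "finite A" "card A \<le> N" "x \<in> X"
  shows "ennreal (norm (x - proj smul e es A x) / norm x) \<le> kc_const smul X e es N"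
proof -
  have "ennreal (norm (x - proj smul e es A x) / norm x) \<le> onorm_on X (\<lambda>x. x - proj smul e es A x)"
    unfolding onorm_on_def by (rule SUP_upper[OF assms(3)])
  also have "\<dots> \<le> kc_const smul X e es N"
    unfolding kc_const_def by (rule SUP_upper) (use assms in simp)
  finally show ?thesis .
qed

lemma norm_diff_proj_le_kc:
  assumes "finite A" "card A \<le> N" "x \<in> X" "kc_const smul X e es N < top"
  shows "norm (x - proj smul e es A x) \<le> enn2real (kc_const smul X e es N) * norm x"
proof (cases "x = 0")
  case True
  then show ?thesis by (simp add: proj_def es_0)
next
  case False
  have "norm (x - proj smul e es A x) / norm x \<le> enn2real (kc_const smul X e es N)"
    using enn2real_mono[OF ratio_le_kc[OF assms(1-3)] assms(4)] by simp
  then show ?thesis using False by (simp add: field_simps)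
qed

text \<open>The empty set gives the identity, whose ratio at \<open>e 0\<close> is 1.\<close>

lemma kc_ge_1: "1 \<le> kc_const smul X e es N"
  using ratio_le_kc[of "{}" N "e 0"] e_in e_nz by (simp add: proj_def)

lemma ratio_le_gc:
  assumes "\<Gamma> \<in> greedy_sets es x k" "1 \<le> k" "k \<le> N" "x \<in> X" "x \<noteq> 0"
  shows "ennreal (norm (x - proj smul e es \<Gamma> x) / norm x) \<le> gc_const smul X e es N"
  unfolding gc_const_def
  by (rule Sup_upper) (intro CollectI exI conjI, rule refl, (rule assms)+)

text \<open>If \<open>g\<close> were below 1, removing the coefficients of a constant-coefficient sum of length \<open>m + 1\<close>
  one at a time would make its norm grow exponentially in \<open>m\<close>, while it is at most linear.\<close>

lemma gc_ge_1:
  assumes "1 \<le> N"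
  shows "1 \<le> gc_const smul X e es N"
proof (rule ccontr)
  assume "\<not> ?thesis"
  then have lt: "gc_const smul X e es N < 1" by simp
  then have "gc_const smul X e es N < top" using ennreal_one_less_top order_less_trans by blast
  define g where "g = enn2real (gc_const smul X e es N)"
  have g: "gc_const smul X e es N = ennreal g" "0 \<le> g"
    using \<open>gc_const smul X e es N < top\<close> by (auto simp: g_def)
  then have "g < 1" using lt by simp
  obtain \<kappa>1 \<kappa>2 where \<kappa>: "0 < \<kappa>1" "\<And>n. \<kappa>1 \<le> norm (e n)" "\<And>n. norm (e n) \<le> \<kappa>2"
    using seminormalized by blast
  define S where "S m = (\<Sum>n\<le>m. smul 1 (e n))" for m :: nat
  have S_X: "S m \<in> X" for m unfolding S_def by (rule X_combination)
  have es_S: "es n (S m) = (if n \<le> m then 1 else 0)" for n m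
    unfolding S_def by (simp add: es_combination del: scale_one)
  have step: "norm (S m) \<le> g * norm (S (Suc m))" for m
  proof -
    have nz: "S (Suc m) \<noteq> 0" using es_S[of 0 "Suc m"] es_0 by force
    \<comment> \<open>All nonzero coefficients of \<open>S (Suc m)\<close> equal 1, so any single
      one of them is greedy; removing the last gives \<open>S m\<close>.\<close>
    have "{Suc m} \<in> greedy_sets es (S (Suc m)) 1"
      by (simp add: greedy_sets_def es_S)
    from ratio_le_gc[OF this _ assms S_X nz]
    have "norm (S (Suc m) - proj smul e es {Suc m} (S (Suc m))) / norm (S (Suc m)) \<le> g"
      using g by simp
    moreover have "S (Suc m) - proj smul e es {Suc m} (S (Suc m)) = S m"
      using es_S[of "Suc m" "Suc m"] by (simp add: proj_def) (simp add: S_def)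
    ultimately show ?thesis using nz by (simp add: field_simps)
  qed
  have "norm (S 0) \<le> g ^ m * norm (S m)" for m
  proof (induction m)
    case (Suc m)
    also have "g ^ m * norm (S m) \<le> g ^ m * (g * norm (S (Suc m)))"
      using step g(2) by (intro mult_left_mono) auto
    finally show ?case by (simp add: mult_ac)
  qed simp
  moreover have "norm (S m) \<le> (real m + 1) * \<kappa>2" for m
    using sum_norm_bound[of "{..m}" e \<kappa>2] \<kappa>(3) by (simp add: S_def algebra_simps)
  ultimately have le: "\<kappa>1 \<le> g ^ m * ((real m + 1) * \<kappa>2)" for m
    using g(2) \<kappa>(2)[of 0] by (simp add: S_def) (meson mult_left_mono order_trans zero_le_power)
  have "(\<lambda>m. (real m * g ^ m + g ^ m) * \<kappa>2) \<longlonglongrightarrow> (0 + 0) * \<kappa>2"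
    using \<open>g < 1\<close> g(2) by (intro tendsto_intros powser_times_n_limit_0 LIMSEQ_power_zero) auto
  then have "(\<lambda>m. g ^ m * ((real m + 1) * \<kappa>2)) \<longlonglongrightarrow> 0"
    by (simp add: algebra_simps)
  then have "\<kappa>1 \<le> 0" using le by (intro LIMSEQ_le_const) auto
  then show False using \<kappa>(1) by simp
qed

text \<open>The supremum in \<open>gc_const\<close> starts at cardinality 1, but the averaging also
  produces empty greedy sets; for these the bound is \<open>gc_ge_1\<close>.\<close>

lemma norm_diff_proj_le_gc:
  assumes "R \<in> greedy_sets es x k" "k \<le> N" "1 \<le> N" "x \<in> X" "gc_const smul X e es N < top"
  shows "norm (x - proj smul e es R x) \<le> enn2real (gc_const smul X e es N) * norm x"
proof -
  consider "x = 0" | "k = 0" | "x \<noteq> 0" "1 \<le> k" by fastforce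
  then show ?thesis
  proof cases
    case 1
    then show ?thesis by (simp add: proj_def es_0)
  next
    case 2
    then have "R = {}" using assms(1) by (auto simp: greedy_sets_def)
    moreover have "1 \<le> enn2real (gc_const smul X e es N)"
      using enn2real_mono[OF gc_ge_1[OF assms(3)] assms(5)] by simp
    ultimately show ?thesis by (simp add: proj_def mult_le_cancel_right1)
  next
    case 3
    have "norm (x - proj smul e es R x) / norm x \<le> enn2real (gc_const smul X e es N)"
      using enn2real_mono[OF ratio_le_gc[OF assms(1) 3(2) assms(2,4) 3(1)] assms(5)] by simp
    then show ?thesis using 3(1) by (simp add: field_simps)
  qed
qed

lemma ratio_le_nu:
  assumes "finite A" "finite B" "A \<noteq> {}" "card A = card B" "card A \<le> N" "\<epsilon> \<in> Upsilon" "\<eta> \<in> Upsilon"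
    "x \<in> X" "\<And>n. norm (es n x) \<le> 1" "A \<inter> B = {}" "\<And>n. n \<in> A \<union> B \<Longrightarrow> es n x = 0"
  shows "ennreal (norm (signed_sum smul e \<epsilon> A + x) / norm (signed_sum smul e \<eta> B + x)) \<le> nu_const smul X e es N"
proof -
  have "B \<noteq> {}" using assms(1-4) by auto
  moreover have "coeff_sup_norm es x \<le> 1"
    unfolding coeff_sup_norm_def by (rule SUP_least) (use assms(9) in simp)
  moreover have "A \<inter> coeff_supp es x = {}" "B \<inter> coeff_supp es x = {}"
    using assms(11) by (auto simp: coeff_supp_def)
  ultimately show ?thesis
    unfolding nu_const_def by (intro Sup_upper) (use assms in blast)
qed

text \<open>The sets compared by \<open>nu_const\<close> are disjoint, so the ratio 1 is not
  directly available. With \<open>x = 0\<close> and the singletons of 0 and 1 in both orders, a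
  ratio and its reciprocal occur, and one of them is at least 1.\<close>

lemma nu_ge_1:
  assumes "1 \<le> N"
  shows "1 \<le> nu_const smul X e es N"
proof -
  have one: "(\<lambda>_. 1) \<in> Upsilon" by (simp add: Upsilon_def)
  have "ennreal (norm (e i) / norm (e j)) \<le> nu_const smul X e es N" if "i \<noteq> j" for i j
    using ratio_le_nu[of "{i}" "{j}" N "\<lambda>_. 1" "\<lambda>_. 1" 0] that assms one
    by (simp add: X_0 es_0 signed_sum_def)
  from this[of 0 1] this[of 1 0]
  have "ennreal (max (norm (e 0) / norm (e 1)) (norm (e 1) / norm (e 0))) \<le> nu_const smul X e es N"
    by (auto simp: max_def)
  moreover have "1 \<le> max (norm (e 0) / norm (e 1)) (norm (e 1) / norm (e 0))"
    using e_nz by (simp add: le_max_iff_disj divide_simps) linarith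
  then have "1 \<le> ennreal (max (norm (e 0) / norm (e 1)) (norm (e 1) / norm (e 0)))"
    using ennreal_leI by fastforce
  ultimately show ?thesis by (rule order_trans[rotated])
qed

text \<open>This is the defining inequality of \<open>nu_const\<close>, scaled by
  \<open>\<alpha>\<close> and extended by convexity from unimodular coefficients on \<open>A\<close>
  to all coefficients of modulus at most \<open>\<alpha>\<close>.\<close>

lemma norm_add_combination_le_nu:
  assumes "finite A" "finite B" "card A = card B" "card A \<le> N" "1 \<le> N" "A \<inter> B = {}"
    and \<eta>: "\<eta> \<in> Upsilon" and \<alpha>: "0 \<le> \<alpha>"
    and c: "\<And>n. n \<in> A \<Longrightarrow> norm (c n) \<le> \<alpha>"
    and w: "w \<in> X" "\<And>n. norm (es n w) \<le> \<alpha>" "\<And>n. n \<in> A \<union> B \<Longrightarrow> es n w = 0"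
    and fin: "nu_const smul X e es N < top"
  shows "norm (w + (\<Sum>n\<in>A. smul (c n) (e n)))
    \<le> enn2real (nu_const smul X e es N) * norm (w + \<alpha> *\<^sub>R signed_sum smul e \<eta> B)"
proof (cases "\<alpha> = 0 \<or> A = {}")
  case True
  \<comment> \<open>Both added sums vanish here, so \<open>nu_ge_1\<close> suffices.\<close>
  have "(\<Sum>n\<in>A. smul (c n) (e n)) = 0"
    using True c by (intro sum.neutral) auto
  moreover have "\<alpha> *\<^sub>R signed_sum smul e \<eta> B = 0"
    using True assms(2,3) by (auto simp: signed_sum_def)
  moreover have "1 \<le> enn2real (nu_const smul X e es N)"
    using enn2real_mono[OF nu_ge_1[OF assms(5)] fin] by simp
  ultimately show ?thesis by (simp only: mult_le_cancel_right1) simp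
next
  case False
  then have "\<alpha> > 0" "A \<noteq> {}" using \<alpha> by auto
  then have "B \<noteq> {}" using assms(1,3) by auto
  define w' where "w' = smul (of_real (1 / \<alpha>)) w"
  have w': "w' \<in> X" "\<And>n. norm (es n w') \<le> 1" "\<And>n. n \<in> A \<union> B \<Longrightarrow> es n w' = 0"
    using w \<open>\<alpha> > 0\<close> by (auto simp: w'_def X_scale es_scale norm_mult norm_divide field_simps)
  have ww': "w = \<alpha> *\<^sub>R w'"
    using \<open>\<alpha> > 0\<close> by (simp only: w'_def scale_of_real) simp
  \<comment> \<open>With denominator 0 the quotient would be 0 and its bound would say nothing about
    the numerator.\<close>
  have nz: "signed_sum smul e \<eta> B + w' \<noteq> 0"
  proof
    assume *: "signed_sum smul e \<eta> B + w' = 0"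
    obtain b where b: "b \<in> B" using \<open>B \<noteq> {}\<close> by auto
    have "es b (signed_sum smul e \<eta> B + w') = \<eta> b"
      using b w' assms(2) by (simp add: signed_sum_def es_add X_combination es_combination)
    moreover have "norm (\<eta> b) = 1" using \<eta> by (simp add: Upsilon_def)
    ultimately show False using * es_0 by auto
  qed
  have "norm (w' + signed_sum smul e \<epsilon> A)
      \<le> enn2real (nu_const smul X e es N) * norm (w' + signed_sum smul e \<eta> B)" if "\<epsilon> \<in> Upsilon" for \<epsilon>
  proof -
    have "norm (signed_sum smul e \<epsilon> A + w') / norm (signed_sum smul e \<eta> B + w')
        \<le> enn2real (nu_const smul X e es N)"
      using enn2real_mono[OF ratio_le_nu[of A B N \<epsilon> \<eta> w'] fin] assms w' that \<open>A \<noteq> {}\<close> by simp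
    then show ?thesis using nz by (simp add: field_simps)
  qed
  then have le: "norm (w' + (\<Sum>n\<in>A. smul (c n / of_real \<alpha>) (e n)))
      \<le> enn2real (nu_const smul X e es N) * norm (w' + signed_sum smul e \<eta> B)"
    using \<open>\<alpha> > 0\<close> c assms(1) by (intro norm_unimodular_combination_le) (auto simp: norm_divide)
  have "\<alpha> *\<^sub>R smul (c n / of_real \<alpha>) x = smul (c n) x" for n x
    using smul_of_real[of \<alpha> "c n / of_real \<alpha>"] \<open>\<alpha> > 0\<close> by simp
  then have "w + (\<Sum>n\<in>A. smul (c n) (e n)) = \<alpha> *\<^sub>R (w' + (\<Sum>n\<in>A. smul (c n / of_real \<alpha>) (e n)))"
    by (simp add: ww' scaleR_add_right scaleR_sum_right)
  moreover have "w + \<alpha> *\<^sub>R signed_sum smul e \<eta> B = \<alpha> *\<^sub>R (w' + signed_sum smul e \<eta> B)"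
    by (simp add: ww' scaleR_add_right)
  ultimately show ?thesis using le \<open>\<alpha> > 0\<close> by (simp add: mult.left_commute)
qed

section \<open>The common estimate for greedy remainders\<close>

text \<open>The bound \<open>M\<close> on the remainders of \<open>y\<close> is left abstract so
  that it can later be taken as g times the norm of \<open>y\<close>, or as k times the norm of
  \<open>x - z\<close>.\<close>

lemma norm_diff_greedy_proj_le:
  assumes A: "finite A" "card A \<le> N" and N: "1 \<le> N" and x: "x \<in> X"
    and \<Gamma>: "\<Gamma> \<in> greedy_sets es x N" and fin: "nu_const smul X e es N < top"
    and y: "y = x - proj smul e es A x"
    and M: "\<And>R k. R \<in> greedy_sets es y k \<Longrightarrow> k \<le> N \<Longrightarrow> norm (y - proj smul e es R y) \<le> M"
  shows "norm (x - proj smul e es \<Gamma> x) \<le> enn2real (nu_const smul X e es N) * M"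
proof -
  define v where "v n = smul (es n x) (e n)" for n
  define \<alpha> where "\<alpha> = Min ((\<lambda>n. norm (es n x)) ` \<Gamma>)"
  have \<Gamma>_fin: "finite \<Gamma>" "card \<Gamma> = N" using \<Gamma> by (auto simp: greedy_sets_def)
  then have "\<Gamma> \<noteq> {}" using N by auto
  have \<alpha>_le: "\<alpha> \<le> norm (es n x)" if "n \<in> \<Gamma>" for n using that \<Gamma>_fin by (simp add: \<alpha>_def)
  have "\<alpha> \<in> (\<lambda>n. norm (es n x)) ` \<Gamma>" unfolding \<alpha>_def using \<Gamma>_fin \<open>\<Gamma> \<noteq> {}\<close> by simp
  then have le_\<alpha>: "norm (es n x) \<le> \<alpha>" if "n \<notin> \<Gamma>" for n
    using \<Gamma> that by (auto simp: greedy_sets_def)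
  have \<alpha>0: "0 \<le> \<alpha>" using \<open>\<alpha> \<in> _\<close> by auto
  define B where "B = \<Gamma> - A"
  have "finite B" using \<Gamma>_fin by (simp add: B_def)
  have card_le: "card (A - \<Gamma>) \<le> card B"
    unfolding B_def using A \<Gamma>_fin by (intro card_le_sym_Diff) auto
  \<comment> \<open>\<open>nu_const\<close> compares sets of equal cardinality, so only \<open>B' = B - D\<close> of the size of \<open>A - \<Gamma>\<close> is
    used; \<open>D\<close> collects the largest coefficients, which makes the sublevel sets of \<open>t\<close> below greedy.\<close>
  obtain D where D: "D \<subseteq> B" "card D = card B - card (A - \<Gamma>)"
      "\<And>n m. n \<in> D \<Longrightarrow> m \<in> B - D \<Longrightarrow> norm (es m x) \<le> norm (es n x)"
    using exists_largest_subset[OF \<open>finite B\<close>, of "card B - card (A - \<Gamma>)" "\<lambda>n. norm (es n x)"]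
    by (metis diff_le_self)
  define B' where "B' = B - D"
  have "finite B'" using \<open>finite B\<close> by (simp add: B'_def)
  have card_B': "card B' = card (A - \<Gamma>)"
    using D card_le \<open>finite B\<close> by (simp add: B'_def card_Diff_subset finite_subset)
  define \<eta> where "\<eta> n = (if es n x = 0 then 1 else es n x / of_real (norm (es n x)))" for n
  have \<eta>: "\<eta> \<in> Upsilon" by (auto simp: Upsilon_def \<eta>_def norm_divide)
  \<comment> \<open>Weight 0 deletes the coefficients on \<open>D\<close>; on \<open>B'\<close> the
    weight lowers the modulus to \<open>\<alpha>\<close>. If a coefficient on \<open>B'\<close>
    vanishes, then \<open>\<alpha> = 0\<close> and the quotient takes the value 0.\<close>
  define t where "t n = (if n \<in> D then 0 else \<alpha> / norm (es n x))" for n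
  \<comment> \<open>\<open>w\<close> is common to both sides of the comparison: besides
    \<open>w\<close>, the greedy remainder of \<open>x\<close> has only coefficients on
    \<open>A - \<Gamma>\<close>, all of modulus at most \<open>\<alpha>\<close>.\<close>
  define w where "w = x - proj smul e es (A \<union> \<Gamma>) x"
  have w: "w \<in> X" "es n w = (if n \<in> A \<union> \<Gamma> then 0 else es n x)" for n
    unfolding w_def using x A \<Gamma>_fin by (auto simp: X_diff X_proj es_diff_proj)
  have proj_v: "proj smul e es S x = sum v S" for S
    by (simp add: proj_def v_def)
  have "A \<union> \<Gamma> = \<Gamma> \<union> (A - \<Gamma>)" by auto
  then have "proj smul e es (A \<union> \<Gamma>) x = sum v \<Gamma> + sum v (A - \<Gamma>)"
    using sum.union_disjoint[of \<Gamma> "A - \<Gamma>" v] A \<Gamma>_fin by (simp add: proj_v)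
  then have "norm (x - proj smul e es \<Gamma> x) = norm (w + (\<Sum>n\<in>A - \<Gamma>. smul (es n x) (e n)))"
    by (simp add: w_def proj_v v_def)
  also have "\<dots> \<le> enn2real (nu_const smul X e es N) * norm (w + \<alpha> *\<^sub>R signed_sum smul e \<eta> B')"
  proof (rule norm_add_combination_le_nu)
    show "card (A - \<Gamma>) \<le> N" using A card_mono[of A "A - \<Gamma>"] by auto
  qed (use A N \<Gamma>_fin \<open>finite B'\<close> card_B' \<eta> \<alpha>0 le_\<alpha> w fin in \<open>auto simp: B'_def B_def\<close>)
  also have "norm (w + \<alpha> *\<^sub>R signed_sum smul e \<eta> B') \<le> M"
  proof -
    have "t n *\<^sub>R v n = \<alpha> *\<^sub>R smul (\<eta> n) (e n)" if "n \<in> B'" for n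
    proof (cases "es n x = 0")
      case True
      then have "\<alpha> = 0" using \<alpha>_le[of n] \<alpha>0 that by (auto simp: B'_def B_def)
      then show ?thesis by (simp add: t_def)
    next
      case False
      then have "of_real (norm (es n x)) * \<eta> n = es n x" by (simp add: \<eta>_def)
      then have "v n = norm (es n x) *\<^sub>R smul (\<eta> n) (e n)" by (metis smul_of_real v_def)
      then show ?thesis using that False by (simp add: t_def B'_def)
    qed
    then have "\<alpha> *\<^sub>R signed_sum smul e \<eta> B' = (\<Sum>n\<in>B'. t n *\<^sub>R v n)"
      by (simp add: signed_sum_def scaleR_sum_right)
    also have "\<dots> = (\<Sum>n\<in>B. t n *\<^sub>R v n)"
      using \<open>finite B\<close> by (intro sum.mono_neutral_left) (auto simp: B'_def t_def)
    finally have eq: "\<alpha> *\<^sub>R signed_sum smul e \<eta> B' = (\<Sum>n\<in>B. t n *\<^sub>R v n)" .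
    show ?thesis unfolding eq
    proof (rule norm_layer_cake_le[OF \<open>finite B\<close>])
      show "0 \<le> t n \<and> t n \<le> 1" if "n \<in> B" for n
        using \<alpha>_le[of n] \<alpha>0 that by (auto simp: t_def B_def divide_le_eq_1)
      fix s :: real assume s: "0 \<le> s" "s \<le> 1"
      \<comment> \<open>At level \<open>s\<close> the average retains the indices of
        \<open>B\<close> with \<open>s < t n\<close>, so \<open>R\<close> is the set removed from
        \<open>y\<close>.\<close>
      define R where "R = {n\<in>B. t n \<le> s}"
      have R: "finite R" "R \<subseteq> \<Gamma>" "R \<inter> A = {}" "R \<subseteq> B"
        using \<open>finite B\<close> by (simp add: R_def) (auto simp: R_def B_def)
      have es_y: "es n y = (if n \<in> A then 0 else es n x)" for n
        using A x by (simp add: y es_diff_proj)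
      \<comment> \<open>On \<open>A\<close> the coefficients of \<open>y\<close> vanish, and outside
        \<open>A \<union> \<Gamma>\<close> they are dominated because \<open>\<Gamma>\<close> is
        greedy for \<open>x\<close>. For \<open>m\<close> in \<open>B - R\<close>,
        \<open>t m > s \<ge> 0\<close> excludes \<open>m\<close> from \<open>D\<close>; then either
        \<open>n\<close> is in \<open>D\<close>, which holds the largest coefficients, or
        \<open>t n < t m\<close> reverses to the moduli.\<close>
      have "norm (es m y) \<le> norm (es n y)" if n: "n \<in> R" and m: "m \<notin> R" for n m
      proof -
        consider "m \<in> A" | "m \<notin> A \<union> \<Gamma>" | "m \<in> B" by (auto simp: B_def)
        then show ?thesis
        proof cases
          case 1
          then show ?thesis by (simp add: es_y)
        next
          case 2
          then show ?thesis using n R \<Gamma> by (auto simp: es_y greedy_sets_def)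
        next
          case 3
          then have tm: "t m > s" using m by (simp add: R_def)
          then have "m \<notin> D" using s by (auto simp: t_def)
          have "norm (es m x) \<le> norm (es n x)"
          proof (cases "n \<in> D")
            case True
            then show ?thesis using D(3)[of n m] 3 \<open>m \<notin> D\<close> by simp
          next
            case False
            have pos: "0 < \<alpha> / norm (es m x)" using tm s \<open>m \<notin> D\<close> by (simp add: t_def)
            then have "0 < \<alpha>" "0 < norm (es m x)" using \<alpha>0 by (auto simp: zero_less_divide_iff)
            moreover have "\<alpha> / norm (es n x) \<le> \<alpha> / norm (es m x)"
              using tm n False \<open>m \<notin> D\<close> by (simp add: t_def R_def)
            moreover have "0 < norm (es n x)"
              using \<alpha>_le[of n] n R \<open>0 < \<alpha>\<close> by fastforce
            ultimately show ?thesis by (simp add: field_simps)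
          qed
          then show ?thesis using 3 n R by (auto simp: es_y B_def)
        qed
      qed
      then have "R \<in> greedy_sets es y (card R)" using R by (auto simp: greedy_sets_def)
      moreover have "card R \<le> N" using R(2) \<Gamma>_fin card_mono by blast
      ultimately have "norm (y - proj smul e es R y) \<le> M" by (rule M)
      moreover have "proj smul e es R y = sum v R"
        using R by (auto simp: proj_def es_y v_def intro!: sum.cong)
      \<comment> \<open>Splitting \<open>A \<union> \<Gamma>\<close> into \<open>A\<close>,
        \<open>R\<close> and the retained indices identifies \<open>y - proj smul e es R y\<close>
        with the averaged vector.\<close>
      moreover have "sum v (A \<union> \<Gamma>) = sum v A + sum v B"
        using sum.union_disjoint[of A B v] A \<open>finite B\<close> by (simp add: B_def)
      moreover have "sum v B = sum v R + (\<Sum>n\<in>{n\<in>B. s < t n}. v n)"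
      proof -
        have "B = R \<union> {n\<in>B. s < t n}" "R \<inter> {n\<in>B. s < t n} = {}" by (auto simp: R_def)
        then show ?thesis using sum.union_disjoint[of R "{n\<in>B. s < t n}" v] \<open>finite B\<close> R(1) by simp
      qed
      ultimately show "norm (w + (\<Sum>n\<in>{n\<in>B. s < t n}. v n)) \<le> M"
        by (simp add: w_def y proj_v algebra_simps)
    qed
  qed
  finally show ?thesis by (simp add: mult_left_mono)
qed

section \<open>The two upper bounds for the Lebesgue constants\<close>

text \<open>The lower bounds 1 exclude the product of 0 and \<open>top\<close>, which is 0 in
  \<open>ennreal\<close>. Hence an infinite factor makes the claim trivial, and otherwise everything
  can be done with real constants.\<close>

lemma Inf_ennreal_le_mult:
  assumes "1 \<le> K" "1 \<le> V"
    and "K < top \<Longrightarrow> V < top \<Longrightarrow> P (enn2real K * enn2real V)"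
  shows "Inf {ennreal C | C. 0 \<le> C \<and> P C} \<le> K * V"
proof (cases "K < top \<and> V < top")
  case True
  then have "K * V = ennreal (enn2real K * enn2real V)"
    by (simp add: ennreal_mult)
  then show ?thesis using assms(3) True by (intro Inf_lower) auto
next
  case False
  then have "K * V = top"
    using assms(1,2) by (auto simp: ennreal_mult_eq_top_iff less_top[symmetric])
  then show ?thesis by simp
qed

theorem lebesgue_tilde_const_le:
  assumes "1 \<le> N"
  shows "lebesgue_tilde_const smul X e es N \<le> gc_const smul X e es N * nu_const smul X e es N"
  unfolding lebesgue_tilde_const_def
proof (rule Inf_ennreal_le_mult[OF gc_ge_1[OF assms] nu_ge_1[OF assms]], intro ballI)
  let ?K = "gc_const smul X e es N" and ?V = "nu_const smul X e es N"
  assume fin: "?K < top" "?V < top"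
  fix x G assume x: "x \<in> X" and G: "G \<in> greedy_operators smul X e es N"
  obtain \<Gamma> where \<Gamma>: "\<Gamma> \<in> greedy_sets es x N" "G x = proj smul e es \<Gamma> x"
    using G x by (auto simp: greedy_operators_def)
  have "1 \<le> enn2real ?K" "1 \<le> enn2real ?V"
    using enn2real_mono[OF gc_ge_1[OF assms] fin(1)] enn2real_mono[OF nu_ge_1[OF assms] fin(2)] by auto
  then have pos: "0 < enn2real ?K * enn2real ?V" by simp
  \<comment> \<open>Division by the positive constant leaves a lower bound to be proved for an
    infimum, hence for each \<open>A\<close> separately.\<close>
  have "norm (x - G x) / (enn2real ?K * enn2real ?V) \<le> sigma_tilde_err smul e es N x"
    unfolding sigma_tilde_err_def
  proof (rule cINF_greatest)
    show "{A. finite A \<and> card A \<le> N} \<noteq> {}" by (auto intro: exI[of _ "{}"])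
    fix A :: "nat set" assume A: "A \<in> {A. finite A \<and> card A \<le> N}"
    have "norm (x - G x) \<le> enn2real ?V * (enn2real ?K * norm (x - proj smul e es A x))"
      unfolding \<Gamma>(2)
    proof (rule norm_diff_greedy_proj_le[OF _ _ assms x \<Gamma>(1) fin(2) refl])
      show "finite A" "card A \<le> N" using A by auto
    qed (use norm_diff_proj_le_gc assms fin(1) X_diff X_proj x in blast)
    then show "norm (x - G x) / (enn2real ?K * enn2real ?V) \<le> norm (x - proj smul e es A x)"
      using pos by (simp add: divide_le_eq mult_ac)
  qed
  then show "norm (x - G x) \<le> enn2real ?K * enn2real ?V * sigma_tilde_err smul e es N x"
    using pos by (simp add: divide_le_eq mult_ac)
qed

text \<open>Since \<open>z\<close> is supported on \<open>A\<close>, removing \<open>R\<close> from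
  \<open>y\<close> is the same as removing \<open>A \<union> R\<close> from \<open>x - z\<close>.
  This union has at most \<open>2 * N\<close> elements, whence the index of k.\<close>

theorem lebesgue_const_le:
  assumes "1 \<le> N"
  shows "lebesgue_const smul X e es N \<le> kc_const smul X e es (2 * N) * nu_const smul X e es N"
  unfolding lebesgue_const_def
proof (rule Inf_ennreal_le_mult[OF kc_ge_1 nu_ge_1[OF assms]], intro ballI)
  let ?K = "kc_const smul X e es (2 * N)" and ?V = "nu_const smul X e es N"
  assume fin: "?K < top" "?V < top"
  fix x G assume x: "x \<in> X" and G: "G \<in> greedy_operators smul X e es N"
  obtain \<Gamma> where \<Gamma>: "\<Gamma> \<in> greedy_sets es x N" "G x = proj smul e es \<Gamma> x"
    using G x by (auto simp: greedy_operators_def)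
  have "1 \<le> enn2real ?K" "1 \<le> enn2real ?V"
    using enn2real_mono[OF kc_ge_1 fin(1)] enn2real_mono[OF nu_ge_1[OF assms] fin(2)] by auto
  then have pos: "0 < enn2real ?K * enn2real ?V" by simp
  have ne: "Sigma_N smul e N \<noteq> {}" by (fastforce simp: Sigma_N_def intro: exI[of _ "{}"])
  have "norm (x - G x) / (enn2real ?K * enn2real ?V) \<le> sigma_err smul e N x"
    unfolding sigma_err_def infdist_notempty[OF ne]
  proof (rule cINF_greatest[OF ne])
    fix z assume "z \<in> Sigma_N smul e N"
    then obtain A a where A: "finite A" "card A \<le> N" and z: "z = (\<Sum>n\<in>A. smul (a n) (e n))"
      by (auto simp: Sigma_N_def)
    have zX: "z \<in> X" unfolding z by (rule X_combination)
    have es_z: "es n z = (if n \<in> A then a n else 0)" for n unfolding z using A(1) by (rule es_combination)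
    have "norm (x - G x) \<le> enn2real ?V * (enn2real ?K * norm (x - z))"
      unfolding \<Gamma>(2)
    proof (rule norm_diff_greedy_proj_le[OF A assms x \<Gamma>(1) fin(2) refl])
      fix R k
      define y where "y = x - proj smul e es A x"
      assume "R \<in> greedy_sets es (x - proj smul e es A x) k" "k \<le> N"
      then have R: "finite R" "card R \<le> N" by (auto simp: greedy_sets_def)
      \<comment> \<open>\<open>R\<close> may meet \<open>A\<close>, where the coefficients of
        \<open>y\<close> are 0, so the sum is split over \<open>A\<close> and
        \<open>R - A\<close>.\<close>
      have "A \<union> R = A \<union> (R - A)" by auto
      then have "proj smul e es (A \<union> R) (x - z)
          = proj smul e es A (x - z) + proj smul e es (R - A) (x - z)"
        unfolding proj_def using A R by (metis (lifting) Diff_disjoint finite_Diff sum.union_disjoint)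
      also have "proj smul e es A (x - z) = proj smul e es A x - z"
        using x zX by (simp add: proj_def es_diff es_z scale_left_diff_distrib sum_subtractf)
          (simp add: z)
      also have "proj smul e es (R - A) (x - z) = proj smul e es R y"
        unfolding proj_def y_def using A R x zX
        by (intro sum.mono_neutral_cong_left)
            (auto simp: es_diff es_z es_diff_proj[unfolded proj_def] es_combination X_combination)
      finally have *: "y - proj smul e es R y = (x - z) - proj smul e es (A \<union> R) (x - z)"
        by (simp add: y_def)
      have "card (A \<union> R) \<le> 2 * N" using card_Un_le[of A R] A R by linarith
      then show "norm (x - proj smul e es A x - proj smul e es R (x - proj smul e es A x))
          \<le> enn2real ?K * norm (x - z)"
        unfolding y_def[symmetric] * using A R x zX fin(1)
        by (intro norm_diff_proj_le_kc) (auto intro: X_diff)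
    qed
    then show "norm (x - G x) / (enn2real ?K * enn2real ?V) \<le> dist x z"
      using pos by (simp add: divide_le_eq mult_ac dist_norm)
  qed
  then show "norm (x - G x) \<le> enn2real ?K * enn2real ?V * sigma_err smul e N x"
    using pos by (simp add: divide_le_eq mult_ac)
qed

end

section \<open>Existence of greedy sets\<close>

text \<open>A greedy set is enlarged by an index whose coefficient is largest outside it; this
  maximum is attained because the coefficients tend to 0. The lemma ensures that greedy operators
  exist in the example.\<close>

lemma exists_greedy_set:
  assumes "(\<lambda>n. es n x) \<longlonglongrightarrow> 0"
  shows "\<exists>\<Gamma>. \<Gamma> \<in> greedy_sets es x N"
proof (induction N)
  case 0
  show ?case by (rule exI[of _ "{}"]) (simp add: greedy_sets_def)
next
  case (Suc N)
  then obtain \<Gamma> where \<Gamma>: "finite \<Gamma>" "card \<Gamma> = N"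
      "\<And>n m. n \<in> \<Gamma> \<Longrightarrow> m \<notin> \<Gamma> \<Longrightarrow> norm (es m x) \<le> norm (es n x)"
    by (auto simp: greedy_sets_def)
  have "\<exists>a. a \<notin> \<Gamma> \<and> (\<forall>m. m \<notin> \<Gamma> \<longrightarrow> norm (es m x) \<le> norm (es a x))"
  proof -
    obtain b where "b \<notin> \<Gamma>" using \<Gamma>(1) ex_new_if_finite infinite_UNIV_nat by blast
    show ?thesis
    proof (cases "\<forall>m. m \<notin> \<Gamma> \<longrightarrow> norm (es m x) \<le> norm (es b x)")
      case True
      then show ?thesis using \<open>b \<notin> \<Gamma>\<close> by blast
    next
      case False
      then obtain k where k: "k \<notin> \<Gamma>" "norm (es b x) < norm (es k x)" by (auto simp: not_le)
      \<comment> \<open>\<open>es k x\<close> is nonzero, so only finitely many coefficients are at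
        least as large, and a maximum over them is a maximum outside
        \<open>\<Gamma>\<close>.\<close>
      define S where "S = {n. n \<notin> \<Gamma> \<and> norm (es k x) \<le> norm (es n x)}"
      have "0 < norm (es k x)" using k(2) norm_ge_zero order_le_less_trans by blast
      then obtain n0 where n0: "\<And>n. n \<ge> n0 \<Longrightarrow> norm (es n x) < norm (es k x)"
        using LIMSEQ_D[OF assms] by fastforce
      have "S \<subseteq> {..<n0}" using n0 by (auto simp: S_def not_le[symmetric])
      then have "finite S" using finite_subset by blast
      have "k \<in> S" using k by (simp add: S_def)
      then have "Max ((\<lambda>n. norm (es n x)) ` S) \<in> (\<lambda>n. norm (es n x)) ` S"
        using \<open>finite S\<close> by (intro Max_in) auto
      then obtain a where "a \<in> S" and max: "Max ((\<lambda>n. norm (es n x)) ` S) = norm (es a x)"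
        by auto
      then have a: "a \<in> S" "\<And>m. m \<in> S \<Longrightarrow> norm (es m x) \<le> norm (es a x)"
        using \<open>finite S\<close> by (auto simp flip: max)
      have "norm (es m x) \<le> norm (es a x)" if "m \<notin> \<Gamma>" for m
        using a that by (cases "m \<in> S") (auto simp: S_def)
      then show ?thesis using a(1) by (auto simp: S_def)
    qed
  qed
  then obtain a where a: "a \<notin> \<Gamma>" "\<And>m. m \<notin> \<Gamma> \<Longrightarrow> norm (es m x) \<le> norm (es a x)" by blast
  show ?case
    by (rule exI[of _ "insert a \<Gamma>"]) (use \<Gamma> a in \<open>auto simp: greedy_sets_def\<close>)
qed

section \<open>The space of null sequences with its unit vectors\<close>

definition bcf_scale :: "'k::real_normed_field \<Rightarrow> (nat, 'k) bcontfun \<Rightarrow> (nat, 'k) bcontfun" where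
  "bcf_scale c f = Bcontfun (\<lambda>n. c * apply_bcontfun f n)"

definition c0_space :: "(nat, 'k::real_normed_field) bcontfun set" where
  "c0_space = {f. apply_bcontfun f \<longlonglongrightarrow> 0}"

definition bcf_unit :: "nat \<Rightarrow> (nat, 'k::real_normed_field) bcontfun" where
  "bcf_unit n = Bcontfun (\<lambda>m. if m = n then 1 else 0)"

definition bcf_coord :: "nat \<Rightarrow> (nat, 'k::real_normed_field) bcontfun \<Rightarrow> 'k" where
  "bcf_coord n f = apply_bcontfun f n"

lemma apply_bcf_scale [simp]: "apply_bcontfun (bcf_scale c f) n = c * apply_bcontfun f n"
proof -
  have "(\<lambda>n. c * apply_bcontfun f n) \<in> bcontfun"
    by (rule bcontfun_normI[where b = "norm c * norm f"])
       (auto simp: norm_mult norm_bounded mult_left_mono)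
  then show ?thesis by (simp add: bcf_scale_def Bcontfun_inverse)
qed

lemma apply_bcf_unit [simp]:
  "apply_bcontfun (bcf_unit n) m = (if m = n then 1 else (0 :: 'a::real_normed_field))"
proof -
  have "(\<lambda>m. if m = n then 1 else (0 :: 'a)) \<in> bcontfun"
    by (rule bcontfun_normI[where b = 1]) auto
  then show ?thesis by (simp add: bcf_unit_def Bcontfun_inverse)
qed

lemma apply_bcf_sum [simp]:
  "apply_bcontfun (\<Sum>i\<in>A. f i) n = (\<Sum>i\<in>A. apply_bcontfun (f i :: (nat, 'k::real_normed_field) bcontfun) n)"
  by (induction A rule: infinite_finite_induct) auto

lemma norm_bcf_scale: "norm (bcf_scale c f) = norm c * norm f"
proof (rule antisym)
  show "norm (bcf_scale c f) \<le> norm c * norm f"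
    by (rule norm_bound) (simp add: norm_mult norm_bounded mult_left_mono)
  show "norm c * norm f \<le> norm (bcf_scale c f)"
  proof (cases "c = 0")
    case False
    have "norm f \<le> norm (bcf_scale c f) / norm c"
    proof (rule norm_bound)
      fix n
      show "norm (apply_bcontfun f n) \<le> norm (bcf_scale c f) / norm c"
        using norm_bounded[of "bcf_scale c f" n] False by (simp add: norm_mult field_simps)
    qed
    then show ?thesis using False by (simp add: field_simps)
  qed simp
qed

lemma norm_bcf_unit: "norm (bcf_unit n) = 1"
proof (rule antisym)
  show "norm (bcf_unit n) \<le> 1" by (rule norm_bound) simp
  show "1 \<le> norm (bcf_unit n)" using norm_bounded[of "bcf_unit n" n] by simp
qed

lemma bcf_unit_in_c0: "(bcf_unit n :: (nat, 'k::real_normed_field) bcontfun) \<in> c0_space"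
proof -
  have "eventually (\<lambda>m. apply_bcontfun (bcf_unit n) m = (0 :: 'k)) sequentially"
    using eventually_gt_at_top[of n] by eventually_elim auto
  then show ?thesis unfolding c0_space_def by (simp add: tendsto_eventually del: apply_bcf_unit)
qed

lemma vector_space_bcf_scale: "vector_space bcf_scale"
  by standard (auto intro!: bcontfun_eqI simp: algebra_simps)

lemma bcf_coord_proj:
  assumes "finite A"
  shows "bcf_coord n (proj bcf_scale bcf_unit bcf_coord A f) = (if n \<in> A then bcf_coord n f else 0)"
  using assms by (simp add: proj_def bcf_coord_def if_distrib[of "\<lambda>c. _ * c"] cong: if_cong)

text \<open>Setting coordinates to 0 cannot raise a supremum norm; this bounds both k and g by 1 in
  the example.\<close>

lemma norm_diff_bcf_proj_le:
  assumes "finite A"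
  shows "norm (f - proj bcf_scale bcf_unit bcf_coord A f) \<le> norm f"
proof (rule norm_bound)
  fix n
  show "norm (apply_bcontfun (f - proj bcf_scale bcf_unit bcf_coord A f) n) \<le> norm f"
    using bcf_coord_proj[OF assms, of n f] norm_bounded[of f n] by (auto simp: bcf_coord_def)
qed

lemma closed_c0_space: "closed c0_space"
  unfolding closed_sequential_limits
proof (intro allI impI, elim conjE)
  fix f :: "nat \<Rightarrow> (nat, 'k::real_normed_field) bcontfun" and l
  assume f: "\<forall>n. f n \<in> c0_space" and lim: "f \<longlonglongrightarrow> l"
  have "apply_bcontfun l \<longlonglongrightarrow> 0"
  proof (rule LIMSEQ_I)
    fix r :: real assume "0 < r"
    then obtain k where k: "dist (f k) l < r / 2"
      using metric_LIMSEQ_D[OF lim, of "r / 2"] by auto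
    obtain n0 where n0: "\<And>n. n \<ge> n0 \<Longrightarrow> norm (apply_bcontfun (f k) n) < r / 2"
      using f LIMSEQ_D[of "apply_bcontfun (f k)" 0 "r / 2"] \<open>0 < r\<close> by (auto simp: c0_space_def)
    have "norm (apply_bcontfun l n - 0) < r" if "n \<ge> n0" for n
      using n0[OF that] dist_fun_lt_imp_dist_val_lt[OF k, of n]
        norm_triangle_sub[of "apply_bcontfun l n" "apply_bcontfun (f k) n"]
      by (simp add: dist_norm norm_minus_commute)
    then show "\<exists>no. \<forall>n\<ge>no. norm (apply_bcontfun l n - 0) < r" by blast
  qed
  then show "l \<in> c0_space" by (simp add: c0_space_def)
qed

text \<open>The library proves \<open>bcontfun\<close> complete only over metric domains, and \<open>nat\<close> is not an instance
  of \<open>metric_space\<close>.\<close>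

lemma complete_c0_space: "complete (c0_space :: (nat, 'k::{real_normed_field,banach}) bcontfun set)"
proof (rule completeI)
  fix f :: "nat \<Rightarrow> (nat, 'k) bcontfun"
  assume f: "\<forall>n. f n \<in> c0_space" and "Cauchy f"
  then obtain g where "uniform_limit UNIV (\<lambda>n. apply_bcontfun (f n)) g sequentially"
    using uniformly_convergent_eq_cauchy[of "\<lambda>_. True" "\<lambda>n. apply_bcontfun (f n)"]
    unfolding Cauchy_def uniform_limit_sequentially_iff
    by (metis dist_fun_lt_imp_dist_val_lt)
  from uniform_limit_bcontfunE[OF this sequentially_bot]
  obtain l where l: "f \<longlonglongrightarrow> l" by metis
  then show "\<exists>l\<in>c0_space. f \<longlonglongrightarrow> l"
    using closed_sequentially[OF closed_c0_space] f by blast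
qed

lemma c0_subset_closure_span: "c0_space \<subseteq> closure (module.span bcf_scale (range bcf_unit))"
proof
  interpret vector_space bcf_scale by (rule vector_space_bcf_scale)
  fix f :: "(nat, 'k::real_normed_field) bcontfun" assume f: "f \<in> c0_space"
  let ?P = "\<lambda>N. proj bcf_scale bcf_unit bcf_coord {..<N} f"
  have "?P N \<in> span (range bcf_unit)" for N
    unfolding proj_def by (intro span_sum span_scale span_base) auto
  moreover have "?P \<longlonglongrightarrow> f"
  proof (rule LIMSEQ_I)
    fix r :: real assume "0 < r"
    \<comment> \<open>Half of \<open>r\<close> is used because the coordinatewise bound on the norm
      is not strict.\<close>
    then obtain n0 where n0: "\<And>n. n \<ge> n0 \<Longrightarrow> norm (apply_bcontfun f n) < r / 2"
      using f LIMSEQ_D[of "apply_bcontfun f" 0 "r / 2"] by (auto simp: c0_space_def)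
    have "norm (?P N - f) < r" if "n0 \<le> N" for N
    proof -
      have "norm (?P N - f) \<le> r / 2"
      proof (rule norm_bound)
        fix n
        show "norm (apply_bcontfun (?P N - f) n) \<le> r / 2"
          using bcf_coord_proj[of "{..<N}" n f] n0[of n] that \<open>0 < r\<close>
          by (cases "n < N") (auto simp: bcf_coord_def intro: less_imp_le)
      qed
      then show ?thesis using \<open>0 < r\<close> by simp
    qed
    then show "\<exists>no. \<forall>N\<ge>no. norm (?P N - f) < r" by blast
  qed
  ultimately show "f \<in> closure (span (range bcf_unit))"
    unfolding closure_sequential by (intro exI[of _ ?P]) simp
qed

lemma seminormalized_c0:
  "seminormalized_biorthogonal_system bcf_scale
     (c0_space :: (nat, 'k::{real_normed_field,banach}) bcontfun set) bcf_unit bcf_coord"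
proof -
  interpret vector_space "bcf_scale :: 'k \<Rightarrow> _" by (rule vector_space_bcf_scale)
  have onorm: "onorm_on c0_space (bcf_coord n :: _ \<Rightarrow> 'k) = 1" for n
  proof (rule antisym)
    show "onorm_on c0_space (bcf_coord n :: _ \<Rightarrow> 'k) \<le> 1"
      unfolding onorm_on_def
      by (rule SUP_least) (simp add: bcf_coord_def divide_le_eq_1 norm_bounded)
    have "ennreal (norm (bcf_coord n (bcf_unit n :: (nat, 'k) bcontfun)) / norm (bcf_unit n :: (nat, 'k) bcontfun))
        \<le> onorm_on c0_space (bcf_coord n :: _ \<Rightarrow> 'k)"
      unfolding onorm_on_def by (rule SUP_upper) (rule bcf_unit_in_c0)
    then show "1 \<le> onorm_on c0_space (bcf_coord n :: _ \<Rightarrow> 'k)"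
      by (simp add: norm_bcf_unit bcf_coord_def)
  qed
  show ?thesis
  proof
    show "bcf_scale (of_real r) x = r *\<^sub>R x" for r and x :: "(nat, 'k) bcontfun"
      by (rule bcontfun_eqI) (simp add: scaleR_conv_of_real)
    show "norm (bcf_scale c x) = norm c * norm x" for c :: 'k and x by (rule norm_bcf_scale)
    have "apply_bcontfun (bcf_scale c f) = (\<lambda>n. c * apply_bcontfun f n)" for c :: 'k and f
      by auto
    then show "subspace (c0_space :: (nat, 'k) bcontfun set)"
      unfolding subspace_def c0_space_def
      by (auto intro: tendsto_add_zero tendsto_mult_right_zero)
    show "complete (c0_space :: (nat, 'k) bcontfun set)"
      by (rule complete_c0_space)
    show "(bcf_unit n :: (nat, 'k) bcontfun) \<in> c0_space" for n by (rule bcf_unit_in_c0)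
    show "(bcf_coord n :: _ \<Rightarrow> 'k) \<in> dual_space bcf_scale c0_space" for n
      unfolding dual_space_def bcf_coord_def
      by (intro CollectI conjI ballI allI exI[of _ 1]) (simp_all add: norm_bounded)
    show "bcf_coord m (bcf_unit n) = (if m = n then 1 else (0::'k))" for m n
      by (simp add: bcf_coord_def)
    show "c0_space \<subseteq> closure (span (range (bcf_unit :: nat \<Rightarrow> (nat, 'k) bcontfun)))"
      by (rule c0_subset_closure_span)
    show "\<exists>\<kappa>1 \<kappa>2 :: real. 0 < \<kappa>1 \<and> (\<forall>n. \<kappa>1 \<le> norm (bcf_unit n :: (nat, 'k) bcontfun) \<and>
        norm (bcf_unit n :: (nat, 'k) bcontfun) \<le> \<kappa>2 \<and>
        ennreal \<kappa>1 \<le> onorm_on c0_space (bcf_coord n :: _ \<Rightarrow> 'k) \<and>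
        onorm_on c0_space (bcf_coord n :: _ \<Rightarrow> 'k) \<le> ennreal \<kappa>2)"
      by (intro exI[of _ 1]) (simp add: onorm norm_bcf_unit)
  qed
qed

section \<open>The constants of the example\<close>

lemma kc_c0_le_1:
  "kc_const bcf_scale (c0_space :: (nat, 'k::real_normed_field) bcontfun set) bcf_unit bcf_coord N \<le> 1"
  unfolding kc_const_def onorm_on_def
  by (intro SUP_least) (auto simp: divide_le_eq_1 norm_diff_bcf_proj_le)

lemma gc_c0_le_1:
  "gc_const bcf_scale (c0_space :: (nat, 'k::real_normed_field) bcontfun set) bcf_unit bcf_coord N \<le> 1"
  unfolding gc_const_def
  by (rule Sup_least) (auto simp: divide_le_eq_1 norm_diff_bcf_proj_le greedy_sets_def)

text \<open>By disjointness of the supports, every coordinate of the numerator has modulus at most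
  1, while any index in \<open>B\<close> gives the denominator a coordinate of modulus exactly
  1.\<close>

lemma nu_c0_le_1:
  "nu_const bcf_scale (c0_space :: (nat, 'k::real_normed_field) bcontfun set) bcf_unit bcf_coord N \<le> 1"
  unfolding nu_const_def
proof (rule Sup_least, clarify)
  fix A B and \<epsilon> \<eta> :: "nat \<Rightarrow> 'k" and x :: "(nat, 'k) bcontfun"
  assume *: "finite A" "finite B" "B \<noteq> {}" "\<epsilon> \<in> Upsilon" "\<eta> \<in> Upsilon"
    "coeff_sup_norm bcf_coord x \<le> 1" "A \<inter> coeff_supp bcf_coord x = {}" "B \<inter> coeff_supp bcf_coord x = {}"
  have coeff: "apply_bcontfun (signed_sum bcf_scale bcf_unit \<epsilon> A + x) n
      = (if n \<in> A then \<epsilon> n else 0) + apply_bcontfun x n" if "finite A" for \<epsilon> :: "nat \<Rightarrow> 'k" and A n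
    using that by (simp add: signed_sum_def if_distrib[of "\<lambda>c. _ * c"] cong: if_cong)
  have x: "norm (apply_bcontfun x n) \<le> 1" for n
  proof -
    have "ennreal (norm (bcf_coord n x)) \<le> coeff_sup_norm bcf_coord x"
      unfolding coeff_sup_norm_def by (rule SUP_upper) simp
    then have "ennreal (norm (bcf_coord n x)) \<le> 1" using *(6) by (rule order_trans)
    then show ?thesis by (simp add: bcf_coord_def)
  qed
  have "norm (signed_sum bcf_scale bcf_unit \<epsilon> A + x) \<le> 1"
  proof (rule norm_bound)
    fix n
    have "n \<in> A \<Longrightarrow> apply_bcontfun x n = 0" using *(7) by (auto simp: coeff_supp_def bcf_coord_def)
    then show "norm (apply_bcontfun (signed_sum bcf_scale bcf_unit \<epsilon> A + x) n) \<le> 1"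
      unfolding coeff[OF *(1)] using x[of n] *(4) by (auto simp: Upsilon_def)
  qed
  moreover have "1 \<le> norm (signed_sum bcf_scale bcf_unit \<eta> B + x)"
  proof -
    obtain b where b: "b \<in> B" using *(3) by auto
    then have "apply_bcontfun x b = 0" using *(8) by (auto simp: coeff_supp_def bcf_coord_def)
    then have "norm (apply_bcontfun (signed_sum bcf_scale bcf_unit \<eta> B + x) b) = 1"
      unfolding coeff[OF *(2)] using b *(5) by (simp add: Upsilon_def)
    then show ?thesis using norm_bounded by metis
  qed
  ultimately show "ennreal (norm (signed_sum bcf_scale bcf_unit \<epsilon> A + x)
      / norm (signed_sum bcf_scale bcf_unit \<eta> B + x)) \<le> 1"
    by (simp add: divide_le_eq_1)
qed

text \<open>The vector has \<open>N + 1\<close> unit coefficients: every greedy operator of order \<open>N\<close> misses one of them.\<close>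

lemma c0_greedy_witness:
  obtains x :: "(nat, 'k::real_normed_field) bcontfun" and G
  where "x \<in> c0_space" "norm x = 1" "G \<in> greedy_operators bcf_scale c0_space bcf_unit bcf_coord N"
    "1 \<le> norm (x - G x)"
proof -
  define x :: "(nat, 'k) bcontfun" where "x = (\<Sum>n\<le>N. bcf_unit n)"
  have coord_x: "apply_bcontfun x n = (if n \<le> N then 1 else 0)" for n
    by (simp add: x_def)
  have x: "x \<in> c0_space"
  proof -
    have "eventually (\<lambda>n. apply_bcontfun x n = 0) sequentially"
      using eventually_gt_at_top[of N] by eventually_elim (simp add: coord_x)
    then show ?thesis by (simp add: c0_space_def tendsto_eventually)
  qed
  have "norm x = 1"
  proof (rule antisym)
    show "norm x \<le> 1" by (rule norm_bound) (simp add: coord_x)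
    show "1 \<le> norm x" using norm_bounded[of x 0] by (simp add: coord_x)
  qed
  \<comment> \<open>A greedy operator has to choose a greedy set for every vector of the space, not
    only for the witness \<open>x\<close>.\<close>
  have "\<forall>y\<in>c0_space. \<exists>\<Gamma>. \<Gamma> \<in> greedy_sets bcf_coord (y :: (nat, 'k) bcontfun) N"
    by (intro ballI exists_greedy_set) (simp add: c0_space_def bcf_coord_def)
  then obtain \<Gamma> where \<Gamma>: "\<And>y :: (nat, 'k) bcontfun. y \<in> c0_space \<Longrightarrow> \<Gamma> y \<in> greedy_sets bcf_coord y N"
    by metis
  define G where "G y = proj bcf_scale bcf_unit bcf_coord (\<Gamma> y) y" for y :: "(nat, 'k) bcontfun"
  have G: "G \<in> greedy_operators bcf_scale c0_space bcf_unit bcf_coord N"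
    using \<Gamma> by (auto simp: greedy_operators_def G_def)
  have \<Gamma>x: "finite (\<Gamma> x)" "card (\<Gamma> x) = N" using \<Gamma>[OF x] by (auto simp: greedy_sets_def)
  have "\<not> {..N} \<subseteq> \<Gamma> x" using card_mono[OF \<Gamma>x(1), of "{..N}"] \<Gamma>x(2) by auto
  then obtain n where n: "n \<le> N" "n \<notin> \<Gamma> x" by auto
  have "apply_bcontfun (x - G x) n = 1"
    using bcf_coord_proj[OF \<Gamma>x(1), of n x] n by (simp add: G_def bcf_coord_def coord_x)
  then have "1 \<le> norm (x - G x)" using norm_bounded[of "x - G x" n] by simp
  then show ?thesis using that x \<open>norm x = 1\<close> G by blast
qed

text \<open>The zero vector is an admissible approximant, so the witness has error at most 1, while
  its greedy remainder has norm at least 1.\<close>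

lemma lebesgue_c0_ge_1:
  "1 \<le> lebesgue_const bcf_scale (c0_space :: (nat, 'k::real_normed_field) bcontfun set) bcf_unit bcf_coord N"
  unfolding lebesgue_const_def
proof (rule Inf_greatest, clarify)
  fix C :: real
  assume "0 \<le> C" and C: "\<forall>x\<in>c0_space. \<forall>G\<in>greedy_operators bcf_scale c0_space bcf_unit bcf_coord N.
      norm (x - G x) \<le> C * sigma_err bcf_scale (bcf_unit :: nat \<Rightarrow> (nat, 'k) bcontfun) N x"
  obtain x :: "(nat, 'k) bcontfun" and G where xG: "x \<in> c0_space" "norm x = 1"
    "G \<in> greedy_operators bcf_scale c0_space bcf_unit bcf_coord N" "1 \<le> norm (x - G x)"
    by (rule c0_greedy_witness)
  have "0 \<in> Sigma_N bcf_scale (bcf_unit :: nat \<Rightarrow> (nat, 'k) bcontfun) N"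
    by (fastforce simp: Sigma_N_def intro: exI[of _ "{}"])
  then have "sigma_err bcf_scale bcf_unit N x \<le> 1"
    using infdist_le[of 0 _ x] xG(2) by (simp add: sigma_err_def)
  then have "C * sigma_err bcf_scale bcf_unit N x \<le> C"
    using \<open>0 \<le> C\<close> by (rule mult_left_le)
  moreover have "norm (x - G x) \<le> C * sigma_err bcf_scale bcf_unit N x"
    using C xG(1,3) by blast
  ultimately have "1 \<le> C" using xG(4) by linarith
  then show "1 \<le> ennreal C" by simp
qed

text \<open>The same witness serves, with the projection onto the empty set as approximant.\<close>

lemma lebesgue_tilde_c0_ge_1:
  "1 \<le> lebesgue_tilde_const bcf_scale (c0_space :: (nat, 'k::real_normed_field) bcontfun set) bcf_unit bcf_coord N"
  unfolding lebesgue_tilde_const_def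
proof (rule Inf_greatest, clarify)
  fix C :: real
  assume "0 \<le> C" and C: "\<forall>x\<in>c0_space. \<forall>G\<in>greedy_operators bcf_scale c0_space bcf_unit bcf_coord N.
      norm (x - G x) \<le> C * sigma_tilde_err bcf_scale (bcf_unit :: nat \<Rightarrow> (nat, 'k) bcontfun) bcf_coord N x"
  obtain x :: "(nat, 'k) bcontfun" and G where xG: "x \<in> c0_space" "norm x = 1"
    "G \<in> greedy_operators bcf_scale c0_space bcf_unit bcf_coord N" "1 \<le> norm (x - G x)"
    by (rule c0_greedy_witness)
  have "sigma_tilde_err bcf_scale bcf_unit bcf_coord N x
      \<le> norm (x - proj bcf_scale bcf_unit bcf_coord {} x)"
    unfolding sigma_tilde_err_def by (rule cINF_lower) (auto intro: bdd_belowI[of _ 0])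
  then have "sigma_tilde_err bcf_scale bcf_unit bcf_coord N x \<le> 1"
    using xG(2) by (simp add: proj_def)
  then have "C * sigma_tilde_err bcf_scale bcf_unit bcf_coord N x \<le> C"
    using \<open>0 \<le> C\<close> by (rule mult_left_le)
  moreover have "norm (x - G x) \<le> C * sigma_tilde_err bcf_scale bcf_unit bcf_coord N x"
    using C xG(1,3) by blast
  ultimately have "1 \<le> C" using xG(4) by linarith
  then show "1 \<le> ennreal C" by simp
qed

section \<open>Upper bounds and sharpness combined\<close>

theorem theorem1p4:
  shows "(\<forall>(smul :: 'k::{real_normed_field,banach} \<Rightarrow> 'a::real_normed_vector \<Rightarrow> 'a) X e es.
            seminormalized_biorthogonal_system smul X e es \<longrightarrow>
            (\<forall>N\<ge>1. lebesgue_const smul X e es N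
                     \<le> kc_const smul X e es (2 * N) * nu_const smul X e es N
                 \<and> lebesgue_tilde_const smul X e es N
                     \<le> gc_const smul X e es N * nu_const smul X e es N))
       \<and> (\<exists>(smul :: 'k \<Rightarrow> (nat, 'k) bcontfun \<Rightarrow> (nat, 'k) bcontfun) X e es.
            seminormalized_biorthogonal_system smul X e es \<and>
            (\<forall>N\<ge>1. lebesgue_const smul X e es N
                     = kc_const smul X e es (2 * N) * nu_const smul X e es N
                 \<and> lebesgue_tilde_const smul X e es N
                     = gc_const smul X e es N * nu_const smul X e es N))"
proof (rule conjI)
  show "\<forall>(smul :: 'k \<Rightarrow> 'a \<Rightarrow> 'a) X e es.
            seminormalized_biorthogonal_system smul X e es \<longrightarrow>
            (\<forall>N\<ge>1. lebesgue_const smul X e es N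
                     \<le> kc_const smul X e es (2 * N) * nu_const smul X e es N
                 \<and> lebesgue_tilde_const smul X e es N
                     \<le> gc_const smul X e es N * nu_const smul X e es N)"
    by (intro allI impI conjI seminormalized_biorthogonal_system.lebesgue_const_le
        seminormalized_biorthogonal_system.lebesgue_tilde_const_le)
  interpret c0: seminormalized_biorthogonal_system bcf_scale
      "c0_space :: (nat, 'k) bcontfun set" bcf_unit bcf_coord
    by (rule seminormalized_c0)
  \<comment> \<open>In the example the constants on the right are at most 1 and the Lebesgue
    constants at least 1, so the general inequality closes the chain
    \<open>L \<le> a * b \<le> 1 \<le> L\<close>.\<close>
  have eq: "L = a * b" if "L \<le> a * b" "1 \<le> L" "a \<le> 1" "b \<le> 1" for L a b :: ennreal
  proof (rule antisym)
    have "a * b \<le> 1" using mult_mono[OF that(3,4)] by simp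
    then show "a * b \<le> L" using that(2) by (rule order_trans)
  qed (rule that(1))
  let ?X = "c0_space :: (nat, 'k) bcontfun set"
  have "\<forall>N\<ge>1. lebesgue_const bcf_scale ?X bcf_unit bcf_coord N
      = kc_const bcf_scale ?X bcf_unit bcf_coord (2 * N) * nu_const bcf_scale ?X bcf_unit bcf_coord N
    \<and> lebesgue_tilde_const bcf_scale ?X bcf_unit bcf_coord N
      = gc_const bcf_scale ?X bcf_unit bcf_coord N * nu_const bcf_scale ?X bcf_unit bcf_coord N"
    by (intro allI impI conjI eq c0.lebesgue_const_le c0.lebesgue_tilde_const_le lebesgue_c0_ge_1
        lebesgue_tilde_c0_ge_1 kc_c0_le_1 gc_c0_le_1 nu_c0_le_1)
  then show "\<exists>(smul :: 'k \<Rightarrow> (nat, 'k) bcontfun \<Rightarrow> (nat, 'k) bcontfun) X e es.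
            seminormalized_biorthogonal_system smul X e es \<and>
            (\<forall>N\<ge>1. lebesgue_const smul X e es N
                     = kc_const smul X e es (2 * N) * nu_const smul X e es N
                 \<and> lebesgue_tilde_const smul X e es N
                     = gc_const smul X e es N * nu_const smul X e es N)"
    by (intro exI) (rule conjI[OF seminormalized_c0])
qed

end
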